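(* Let $n$ be a positive integer, and let $x$ and $y$ be nonnegative integers. Let $A_n(x,y)$ be the $n\times n$ matrix $$A_n(x,y)=\left(\binom{x+y+j}{x-i+2j}-\binom{x+y+j}{x+i+2j}\right)_{1\le i,j\le n}.$$ Then $$\det A_n(x,y)=\prod_{j=1}^{n}\frac{(j-1)!\,(x+y+2j)!\,(x-y+2j+1)_j\,(x+2y+3j+1)_{n-j}}{(x+n+2j)!\,(y+n-j)!}.$$
   Context: Shifted factorial: $(\alpha)_k=\alpha(\alpha+1)\cdots(\alpha+k-1)$ for $k\ge1$, and $(\alpha)_0=1$. For an integer $N\ge0$ and an integer $k$, the binomial coefficient $\binom Nk$ is $0$ if $k<0$ or $k>N$. *)

theory Defs
  imports "Jordan_Normal_Form.Determinant"
begin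

text \<open>The library's \<open>choose\<close> takes a natural lower index; here the lower index may be negative.\<close>

definition binom :: "nat \<Rightarrow> int \<Rightarrow> int" where
  "binom N k = (if k < 0 then 0 else int (N choose nat k))"

text \<open>Rows and columns of \<open>mat n n\<close> are numbered from 0, hence the shift to \<open>1 \<le> i, j \<le> n\<close>.\<close>

definition A_entry :: "nat \<Rightarrow> nat \<Rightarrow> nat \<Rightarrow> nat \<Rightarrow> int" where
  "A_entry x y i j =
     binom (x + y + j) (int x - int i + 2 * int j) - binom (x + y + j) (int x + int i + 2 * int j)"

definition A_mat :: "nat \<Rightarrow> nat \<Rightarrow> nat \<Rightarrow> int mat" where
  "A_mat n x y = mat n n (\<lambda>(i, j). A_entry x y (i + 1) (j + 1))"

end

theory Submission
  imports Defs "Jordan_Normal_Form.Char_Poly"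
begin

text \<open>
  Column \<open>j\<close> of \<open>A_n(x,y)\<close> lists the coefficients of \<open>t^(-i)\<close> minus those of \<open>t^i\<close> in the Laurent
  polynomial \<open>(1 + t)^(x+y+j) t^(-x-2j)\<close>; equivalently, row \<open>i\<close> takes the constant term against
  \<open>t^i - t^(-i)\<close>. Replacing these antisymmetric test polynomials by
  \<open>(t - 1/t) (t + 2 + 1/t)^(i-1)\<close>, which have leading term \<open>t^i\<close> and are integral combinations of
  them, is a unitriangular row operation. Since \<open>t + 2 + 1/t = (1 + t)^2 / t\<close>, the power of
  \<open>t + 2 + 1/t\<close> only changes the exponents in the Laurent polynomial, and the factor \<open>t - 1/t\<close> makes the
  new entries differences \<open>binom M r - binom M (r - 2)\<close> with \<open>M = x + y + 2i + j - 2\<close> and \<open>r = y + i - j\<close>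
  (\<open>det_A_mat_eq_det_ballot_mat\<close>).

  The point of the change is that the new family of matrices is closed under taking contiguous
  submatrices: increasing \<open>i\<close> by one amounts to \<open>(x, y) \<mapsto> (x + 1, y + 1)\<close>, increasing \<open>j\<close> by one to
  \<open>(x, y) \<mapsto> (x + 2, y - 1)\<close>. The Desnanot-Jacobi identity therefore becomes a recurrence in \<open>n\<close>,

    \<open>D_n(x,y) D_(n-2)(x+3,y) = D_(n-1)(x,y) D_(n-1)(x+3,y) - D_(n-1)(x+1,y+1) D_(n-1)(x+2,y-1)\<close>,

  and the product formula satisfies the same recurrence (\<open>prod_formula_condensation\<close>): with \<open>P_n\<close>
  for the product, all three terms are simple rational multiples of \<open>P_(n-1)(x,y) P_(n-1)(x+3,y)\<close>, which
  reduces the claim to one polynomial identity. The initial values are those for \<open>n = 0\<close> and \<open>n = 1\<close>.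

  The recurrence determines \<open>D_n\<close> only where \<open>D_(n-2)(x+3,y)\<close> does not vanish, and for integers with
  \<open>x < y\<close> it may vanish. So \<open>x\<close> is taken to be a positive real number. The factors of the product
  formula vanish only at integers, hence the induction works for all non-integral \<open>x\<close>
  (\<open>det_ballot_mat_nonintegral\<close>), and both sides are continuous in \<open>x\<close>, which gives the integral values.
\<close>

section \<open>The Desnanot-Jacobi identity\<close>

text \<open>
  Expanding along row \<open>0\<close> leaves two minors: one is upper triangular, the other has a last row
  with zeros after its first entry.
\<close>

lemma det_unit_columns_between:
  fixes B :: "'a :: comm_ring_1 mat"
  assumes B: "B \<in> carrier_mat (Suc (Suc m)) (Suc (Suc m))"
    and unit: "\<And>i j. i < Suc (Suc m) \<Longrightarrow> 0 < j \<Longrightarrow> j \<le> m \<Longrightarrow> B $$ (i, j) = (if i = j then 1 else 0)"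
  shows "det B = B $$ (0, 0) * B $$ (Suc m, Suc m) - B $$ (0, Suc m) * B $$ (Suc m, 0)"
proof -
  define U where "U = mat_delete B 0 0"
  define V where "V = mat_delete B 0 (Suc m)"
  have dim: "dim_row B = Suc (Suc m)" "dim_col B = Suc (Suc m)"
    using B by auto
  have U: "U \<in> carrier_mat (Suc m) (Suc m)" and V: "V \<in> carrier_mat (Suc m) (Suc m)"
    using mat_delete_carrier[OF B] by (auto simp: U_def V_def)
  have Uij: "U $$ (i, j) = B $$ (Suc i, Suc j)" if "i < Suc m" "j < Suc m" for i j
    using that by (simp add: U_def mat_delete_def dim)
  have Vij: "V $$ (i, j) = B $$ (Suc i, j)" if "i < Suc m" "j < Suc m" for i j
    using that by (simp add: V_def mat_delete_def dim)
  have "det U = prod_list (diag_mat U)"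
  proof (rule det_upper_triangular[OF _ U], rule upper_triangularI)
    fix i j assume "j < i" "i < dim_row U"
    then show "U $$ (i, j) = 0"
      using U by (auto simp: Uij unit)
  qed
  also have "\<dots> = (\<Prod>i<Suc m. U $$ (i, i))"
    using U by (simp add: prod_list_diag_prod lessThan_atLeast0)
  also have "\<dots> = B $$ (Suc m, Suc m)"
    by (simp add: Uij unit)
  finally have detU: "det U = B $$ (Suc m, Suc m)" .
  have "det V = (\<Sum>j<Suc m. V $$ (m, j) * cofactor V m j)"
    by (rule laplace_expansion_row[OF V]) simp
  also have "\<dots> = (\<Sum>j<Suc m. if j = 0 then V $$ (m, 0) * cofactor V m 0 else 0)"
    by (intro sum.cong) (auto simp: Vij unit)
  also have "\<dots> = B $$ (Suc m, 0) * cofactor V m 0"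
    by (subst sum.delta) (auto simp: Vij)
  also have "mat_delete V m 0 = 1\<^sub>m m"
    using V by (intro eq_matI) (auto simp: mat_delete_def Vij unit)
  then have "cofactor V m 0 = (-1) ^ m"
    by (simp add: cofactor_def)
  finally have detV: "det V = B $$ (Suc m, 0) * (-1) ^ m" .
  have "det B = (\<Sum>j<Suc (Suc m). B $$ (0, j) * cofactor B 0 j)"
    by (rule laplace_expansion_row[OF B]) simp
  also have "\<dots> = (\<Sum>j\<in>{0, Suc m}. B $$ (0, j) * cofactor B 0 j)"
    by (rule sum.mono_neutral_right) (auto simp: unit)
  also have "\<dots> = B $$ (0, 0) * det U - B $$ (0, Suc m) * (-1) ^ m * det V"
    by (simp add: cofactor_def U_def V_def)
  also have "\<dots> = B $$ (0, 0) * B $$ (Suc m, Suc m) - B $$ (0, Suc m) * B $$ (Suc m, 0)"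
  proof -
    have "(-1) ^ m * (-1) ^ m = (1 :: 'a)"
      by (simp flip: power_mult_distrib)
    then show ?thesis
      by (simp add: detU detV algebra_simps)
  qed
  finally show ?thesis .
qed

text \<open>
  Let \<open>B\<close> be the identity matrix with its two outer columns replaced by those of the adjugate of \<open>A\<close>.
  Then \<open>A * B\<close> is \<open>A\<close> with its two outer columns replaced by \<open>det A\<close> times unit vectors, so its determinant
  is \<open>(det A)^2\<close> times the inner minor, while \<open>det B\<close> is a \<open>2\<times>2\<close> determinant of cofactors. Comparing with
  \<open>det A * det B\<close> and cancelling \<open>det A\<close> gives the identity.
\<close>

lemma desnanot_jacobi_nonsingular:
  fixes A :: "'a :: idom mat"
  assumes A: "A \<in> carrier_mat (Suc (Suc m)) (Suc (Suc m))"
    and nz: "det A \<noteq> 0"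
  shows "det A * det (mat_delete (mat_delete A 0 0) m m) =
    det (mat_delete A (Suc m) (Suc m)) * det (mat_delete A 0 0)
      - det (mat_delete A 0 (Suc m)) * det (mat_delete A (Suc m) 0)"
proof -
  let ?n = "Suc (Suc m)"
  define d where "d = det A"
  define B where "B = mat ?n ?n (\<lambda>(i, j). if j = 0 \<or> j = Suc m then adj_mat A $$ (i, j)
    else if i = j then 1 else 0)"
  define AB where "AB = A * B"
  have dim: "dim_row A = ?n" "dim_col A = ?n"
    using A by auto
  have B: "B \<in> carrier_mat ?n ?n"
    by (simp add: B_def)
  have AB: "AB \<in> carrier_mat ?n ?n"
    using A B by (simp add: AB_def)
  have adj: "adj_mat A \<in> carrier_mat ?n ?n" "A * adj_mat A = d \<cdot>\<^sub>m 1\<^sub>m ?n"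
    using adj_mat[OF A] by (auto simp: d_def)
  have outer: "AB $$ (i, j) = (if i = j then d else 0)"
    if "i < ?n" "j = 0 \<or> j = Suc m" for i j
  proof -
    have "AB $$ (i, j) = row A i \<bullet> col B j"
      using A B that by (auto simp: AB_def)
    also have "col B j = col (adj_mat A) j"
      using B adj that by (intro eq_vecI) (auto simp: B_def)
    also have "row A i \<bullet> col (adj_mat A) j = (A * adj_mat A) $$ (i, j)"
      using A adj(1) that by auto
    also have "\<dots> = (if i = j then d else 0)"
      using that by (auto simp: adj(2))
    finally show ?thesis .
  qed
  have inner: "AB $$ (i, j) = A $$ (i, j)" if "i < ?n" "0 < j" "j \<le> m" for i j
  proof -
    have "AB $$ (i, j) = (\<Sum>k\<in>{0..<?n}. A $$ (i, k) * B $$ (k, j))"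
      using A B that by (auto simp: AB_def scalar_prod_def)
    also have "\<dots> = (\<Sum>k\<in>{0..<?n}. if k = j then A $$ (i, j) else 0)"
      using that by (intro sum.cong) (auto simp: B_def)
    also have "\<dots> = A $$ (i, j)"
      using that by (subst sum.delta) auto
    finally show ?thesis .
  qed
  define M where "M = mat_delete AB 0 0"
  have M: "M \<in> carrier_mat (Suc m) (Suc m)"
    using mat_delete_carrier[OF AB] by (simp add: M_def)
  have Mij: "M $$ (i, j) = AB $$ (Suc i, Suc j)" if "i < Suc m" "j < Suc m" for i j
    using that AB by (simp add: M_def mat_delete_def)
  have "det AB = (\<Sum>i<?n. AB $$ (i, 0) * cofactor AB i 0)"
    by (rule laplace_expansion_column[OF AB]) simp
  also have "\<dots> = (\<Sum>i<?n. if i = 0 then d * cofactor AB 0 0 else 0)"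
    by (intro sum.cong) (auto simp: outer)
  also have "\<dots> = d * det M"
    by (subst sum.delta) (auto simp: cofactor_def M_def)
  also have "det M = (\<Sum>i<Suc m. M $$ (i, m) * cofactor M i m)"
    by (rule laplace_expansion_column[OF M]) simp
  also have "\<dots> = (\<Sum>i<Suc m. if i = m then d * cofactor M m m else 0)"
    by (intro sum.cong) (auto simp: outer Mij)
  also have "\<dots> = d * det (mat_delete M m m)"
    by (subst sum.delta) (auto simp: cofactor_def)
  also have "mat_delete M m m = mat_delete (mat_delete A 0 0) m m"
    using A M by (intro eq_matI) (auto simp: mat_delete_def Mij inner)
  finally have "d * (d * det (mat_delete (mat_delete A 0 0) m m)) = det AB"
    by simp
  also have "\<dots> = d * det B"
    unfolding AB_def d_def by (rule det_mult[OF A B])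
  finally have "d * det (mat_delete (mat_delete A 0 0) m m) = det B"
    using nz by (simp add: d_def)
  also have "\<dots> = cofactor A 0 0 * cofactor A (Suc m) (Suc m) - cofactor A (Suc m) 0 * cofactor A 0 (Suc m)"
    by (subst det_unit_columns_between[OF B]) (auto simp: B_def adj_mat_def dim)
  also have "\<dots> = det (mat_delete A (Suc m) (Suc m)) * det (mat_delete A 0 0)
      - det (mat_delete A 0 (Suc m)) * det (mat_delete A (Suc m) 0)"
  proof -
    have "(-1) ^ m * (-1) ^ m = (1 :: 'a)"
      by (simp flip: power_mult_distrib)
    then show ?thesis
      by (simp add: cofactor_def)
  qed
  finally show ?thesis
    by (simp add: d_def)
qed

text \<open>
  Nonsingularity is forced by passing to the matrix \<open>X + A\<close> over the polynomial ring, which is the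
  characteristic matrix of \<open>- A\<close>: its determinant is monic, and the identity survives setting \<open>X\<close> to \<open>0\<close>.
\<close>

lemma desnanot_jacobi:
  fixes A :: "'a :: idom mat"
  assumes A: "A \<in> carrier_mat (Suc (Suc m)) (Suc (Suc m))"
  shows "det A * det (mat_delete (mat_delete A 0 0) m m) =
    det (mat_delete A (Suc m) (Suc m)) * det (mat_delete A 0 0)
      - det (mat_delete A 0 (Suc m)) * det (mat_delete A (Suc m) 0)"
proof -
  define C where "C = char_poly_matrix (- A)"
  have ev_hom: "comm_ring_hom (\<lambda>p :: 'a poly. poly p 0)"
    by unfold_locales auto
  let ?ev = "map_mat (\<lambda>p :: 'a poly. poly p 0)"
  have A': "- A \<in> carrier_mat (Suc (Suc m)) (Suc (Suc m))"
    using A by simp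
  have C: "C \<in> carrier_mat (Suc (Suc m)) (Suc (Suc m))"
    using A' by (simp add: C_def)
  have evC: "?ev C = A"
    using A by (intro eq_matI) (auto simp: C_def char_poly_matrix_def)
  have ev_delete: "?ev (mat_delete X i j) = mat_delete (?ev X) i j" for X i j
    by (intro eq_matI) (auto simp: mat_delete_def)
  have "det C \<noteq> 0"
    using degree_monic_char_poly[OF A'] by (auto simp: C_def char_poly_def)
  then have eq: "det C * det (mat_delete (mat_delete C 0 0) m m) =
    det (mat_delete C (Suc m) (Suc m)) * det (mat_delete C 0 0)
      - det (mat_delete C 0 (Suc m)) * det (mat_delete C (Suc m) 0)"
    by (rule desnanot_jacobi_nonsingular[OF C])
  have "poly (det X) 0 = det (?ev X)" for X
    by (rule comm_ring_hom.hom_det[OF ev_hom, symmetric])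
  then show ?thesis
    using arg_cong[OF eq, of "\<lambda>p. poly p 0"] by (simp add: ev_delete evC)
qed

lemma det_condensation:
  fixes f :: "nat \<Rightarrow> nat \<Rightarrow> 'a :: idom"
  shows "det (mat (Suc (Suc m)) (Suc (Suc m)) (\<lambda>(i, j). f i j))
      * det (mat m m (\<lambda>(i, j). f (Suc i) (Suc j))) =
    det (mat (Suc m) (Suc m) (\<lambda>(i, j). f i j))
      * det (mat (Suc m) (Suc m) (\<lambda>(i, j). f (Suc i) (Suc j)))
    - det (mat (Suc m) (Suc m) (\<lambda>(i, j). f (Suc i) j))
      * det (mat (Suc m) (Suc m) (\<lambda>(i, j). f i (Suc j)))"
proof -
  define A where "A = mat (Suc (Suc m)) (Suc (Suc m)) (\<lambda>(i, j). f i j)"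
  have "mat_delete (mat_delete A 0 0) m m = mat m m (\<lambda>(i, j). f (Suc i) (Suc j))"
    "mat_delete A (Suc m) (Suc m) = mat (Suc m) (Suc m) (\<lambda>(i, j). f i j)"
    "mat_delete A 0 0 = mat (Suc m) (Suc m) (\<lambda>(i, j). f (Suc i) (Suc j))"
    "mat_delete A 0 (Suc m) = mat (Suc m) (Suc m) (\<lambda>(i, j). f (Suc i) j)"
    "mat_delete A (Suc m) 0 = mat (Suc m) (Suc m) (\<lambda>(i, j). f i (Suc j))"
    by (auto intro!: eq_matI simp: A_def mat_delete_def)
  moreover have "A \<in> carrier_mat (Suc (Suc m)) (Suc (Suc m))"
    by (simp add: A_def)
  ultimately show ?thesis
    using desnanot_jacobi[of A m] by (simp add: A_def)
qed

section \<open>Triangular change of test polynomials\<close>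

text \<open>
  The constant term of \<open>t^k - t^(-k)\<close> against \<open>(1 + t)^N t^(-p)\<close>.
\<close>

definition antisym_binom :: "nat \<Rightarrow> int \<Rightarrow> nat \<Rightarrow> int" where
  "antisym_binom N p k = binom N (p - int k) - binom N (p + int k)"

lemma binom_symmetric: "binom N (int N - k) = binom N k"
proof (cases "0 \<le> k \<and> k \<le> int N")
  case True
  then show ?thesis
    using binomial_symmetric[of "nat k" N] by (simp add: binom_def nat_diff_distrib nat_le_iff)
next
  case False
  then show ?thesis
    by (auto simp: binom_def)
qed

lemma binom_Suc: "binom (Suc N) k = binom N k + binom N (k - 1)"
proof (cases "k > 0")
  case True
  then obtain l where "k = int (Suc l)"
    by (metis zero_less_imp_eq_int gr0_implies_Suc)
  then show ?thesis
    by (simp add: binom_def nat_add_distrib)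
next
  case False
  then show ?thesis
    by (auto simp: binom_def)
qed

lemma antisym_binom_0 [simp]: "antisym_binom N p 0 = 0"
  by (simp add: antisym_binom_def)

text \<open>
  Multiplication of \<open>(1 + t)^N t^(-p)\<close> by \<open>(1 + t)^2 / t = t + 2 + 1/t\<close>.
\<close>

lemma antisym_binom_Suc_Suc:
  "antisym_binom (Suc (Suc N)) (p + 1) (Suc k) =
    antisym_binom N p k + 2 * antisym_binom N p (Suc k) + antisym_binom N p (Suc (Suc k))"
  by (simp add: antisym_binom_def binom_Suc algebra_simps)

text \<open>
  For \<open>k > 0\<close> this is the coefficient of \<open>t^k\<close> in \<open>(t - 1/t) (t + 2 + 1/t)^i\<close>. That Laurent polynomial is
  antisymmetric under \<open>t \<mapsto> 1/t\<close>, so its constant coefficient is \<open>0\<close> and it is the combination of the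
  \<open>t^k - t^(-k)\<close>, \<open>k > 0\<close>, with these coefficients.
\<close>

fun ballot :: "nat \<Rightarrow> nat \<Rightarrow> int" where
  "ballot 0 k = (if k = 1 then 1 else 0)"
| "ballot (Suc i) 0 = 0"
| "ballot (Suc i) (Suc k) = ballot i k + 2 * ballot i (Suc k) + ballot i (Suc (Suc k))"

lemma ballot_right_0 [simp]: "ballot i 0 = 0"
  by (cases i) auto

lemma ballot_eq_0: "Suc i < k \<Longrightarrow> ballot i k = 0"
  by (induction i k rule: ballot.induct) auto

lemma ballot_diag: "ballot i (Suc i) = 1"
  by (induction i) (auto simp: ballot_eq_0)

text \<open>
  Moving the factor \<open>(t + 2 + 1/t)^i\<close> from the test polynomial \<open>(t - 1/t) (t + 2 + 1/t)^i\<close> to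
  \<open>(1 + t)^N t^(-p)\<close> turns the latter into \<open>(1 + t)^(N+2i) t^(-p-i)\<close>.
\<close>

lemma antisym_binom_eq_ballot_sum:
  assumes "i < n"
  shows "antisym_binom (N + 2 * i) (p + int i) 1 =
    (\<Sum>k<n. ballot i (Suc k) * antisym_binom N p (Suc k))"
  using assms
proof (induction i arbitrary: N p)
  case 0
  have "(\<Sum>k<n. ballot 0 (Suc k) * antisym_binom N p (Suc k)) =
    (\<Sum>k<n. if k = 0 then antisym_binom N p 1 else 0)"
    by (intro sum.cong) auto
  also have "\<dots> = antisym_binom N p 1"
    using 0 by (subst sum.delta) auto
  finally show ?case by simp
next
  case (Suc i)
  let ?a = "antisym_binom N p"
  \<comment> \<open>Both shifts of the summation index are free of boundary terms, by the zeros at \<open>k = 0\<close>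
    and \<open>k > i + 1\<close>.\<close>
  have down: "(\<Sum>k<n. ballot i (Suc k) * ?a k) = (\<Sum>k<n. ballot i (Suc (Suc k)) * ?a (Suc k))"
    using sum.lessThan_Suc[of "\<lambda>k. ballot i (Suc k) * ?a k" n]
      sum.lessThan_Suc_shift[of "\<lambda>k. ballot i (Suc k) * ?a k" n] Suc.prems
    by (simp add: ballot_eq_0)
  have up: "(\<Sum>k<n. ballot i (Suc k) * ?a (Suc (Suc k))) = (\<Sum>k<n. ballot i k * ?a (Suc k))"
    using sum.lessThan_Suc[of "\<lambda>k. ballot i k * ?a (Suc k)" n]
      sum.lessThan_Suc_shift[of "\<lambda>k. ballot i k * ?a (Suc k)" n] Suc.prems
    by (simp add: ballot_eq_0)
  have "antisym_binom (N + 2 * Suc i) (p + int (Suc i)) 1 =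
      antisym_binom (Suc (Suc N) + 2 * i) (p + 1 + int i) 1"
    by (simp add: algebra_simps)
  also have "\<dots> = (\<Sum>k<n. ballot i (Suc k) * antisym_binom (Suc (Suc N)) (p + 1) (Suc k))"
    using Suc.prems by (intro Suc.IH) simp
  also have "\<dots> = (\<Sum>k<n. ballot i (Suc k) * ?a k) + 2 * (\<Sum>k<n. ballot i (Suc k) * ?a (Suc k))
      + (\<Sum>k<n. ballot i (Suc k) * ?a (Suc (Suc k)))"
    by (simp only: antisym_binom_Suc_Suc) (simp add: sum.distrib sum_distrib_left algebra_simps)
  also have "\<dots> = (\<Sum>k<n. ballot (Suc i) (Suc k) * ?a (Suc k))"
    unfolding down up by (simp add: sum.distrib sum_distrib_left algebra_simps)
  finally show ?case .
qed

text \<open>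
  The binomial coefficient that is polynomial in its upper argument, extended by \<open>0\<close> to negative
  lower indices; a real upper argument allows \<open>x\<close> to vary continuously.
\<close>

definition gbinom :: "real \<Rightarrow> int \<Rightarrow> real" where
  "gbinom z r = (if r < 0 then 0 else z gchoose nat r)"

definition ballot_entry :: "real \<Rightarrow> nat \<Rightarrow> nat \<Rightarrow> nat \<Rightarrow> real" where
  "ballot_entry x y i j =
    gbinom (x + y + 2 * i + j + 1) (int y + int i - int j)
      - gbinom (x + y + 2 * i + j + 1) (int y + int i - int j - 2)"

definition ballot_mat :: "nat \<Rightarrow> real \<Rightarrow> nat \<Rightarrow> real mat" where
  "ballot_mat n x y = mat n n (\<lambda>(i, j). ballot_entry x y i j)"

lemma gbinom_of_nat: "gbinom (real N) r = of_int (binom N r)"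
  by (simp add: gbinom_def binom_def binomial_gbinomial)

text \<open>
  The upper index is \<open>M = x + y + 2i + j + 1\<close> when \<open>i\<close> and \<open>j\<close> count from \<open>0\<close>. Reflecting the lower indices
  by \<open>k \<mapsto> M - k\<close> removes \<open>x\<close> from them, so that the entries become polynomials in \<open>x\<close>.
\<close>

lemma antisym_binom_eq_ballot_entry:
  "of_int (antisym_binom (x + y + Suc j + 2 * i) (int x + 2 * int (Suc j) + int i) 1)
    = ballot_entry (real x) y i j"
proof -
  let ?M = "x + y + 2 * i + j + 1"
  have "real x + real y + real (2 * i) + real j + 1 = real ?M"
    by simp
  then have "ballot_entry (real x) y i j =
      of_int (binom ?M (int y + int i - int j) - binom ?M (int y + int i - int j - 2))"
    by (simp only: ballot_entry_def gbinom_of_nat of_int_diff)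
  also have "binom ?M (int y + int i - int j) = binom ?M (int x + 2 * int (Suc j) + int i - 1)"
    by (subst binom_symmetric[symmetric]) (simp add: algebra_simps)
  also have "binom ?M (int y + int i - int j - 2) = binom ?M (int x + 2 * int (Suc j) + int i + 1)"
    by (subst binom_symmetric[symmetric]) (simp add: algebra_simps)
  finally show ?thesis
    by (simp add: antisym_binom_def algebra_simps)
qed

lemma det_A_mat_eq_det_ballot_mat: "of_int (det (A_mat n x y)) = det (ballot_mat n (real x) y)"
proof -
  define L where "L = mat n n (\<lambda>(i, k). ballot i (Suc k))"
  have L: "L \<in> carrier_mat n n" and A: "A_mat n x y \<in> carrier_mat n n"
    by (simp_all add: L_def A_mat_def)
  have "det L = prod_list (diag_mat L)"
    by (rule det_lower_triangular[OF _ L]) (auto simp: L_def ballot_eq_0)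
  also have "\<dots> = 1"
    using L by (simp add: prod_list_diag_prod) (simp add: L_def ballot_diag)
  finally have "det (A_mat n x y) = det (L * A_mat n x y)"
    by (simp add: det_mult[OF L A])
  also have "real_of_int \<dots> = det (map_mat real_of_int (L * A_mat n x y))"
    by simp
  also have "map_mat real_of_int (L * A_mat n x y) = ballot_mat n (real x) y"
  proof (rule eq_matI)
    fix i j assume "i < dim_row (ballot_mat n (real x) y)" "j < dim_col (ballot_mat n (real x) y)"
    then have ij: "i < n" "j < n"
      by (auto simp: ballot_mat_def)
    have "(L * A_mat n x y) $$ (i, j) =
        (\<Sum>k<n. ballot i (Suc k) * antisym_binom (x + y + Suc j) (int x + 2 * int (Suc j)) (Suc k))"
      using ij L A
      by (auto simp: scalar_prod_def L_def A_mat_def A_entry_def antisym_binom_def lessThan_atLeast0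
          algebra_simps intro!: sum.cong)
    also have "\<dots> = antisym_binom (x + y + Suc j + 2 * i) (int x + 2 * int (Suc j) + int i) 1"
      by (rule antisym_binom_eq_ballot_sum[symmetric]) (rule ij)
    finally show "map_mat real_of_int (L * A_mat n x y) $$ (i, j) = ballot_mat n (real x) y $$ (i, j)"
      using ij L A antisym_binom_eq_ballot_entry[of x y j i] by (simp add: ballot_mat_def)
  qed (use L A in \<open>auto simp: ballot_mat_def\<close>)
  finally show ?thesis .
qed

section \<open>Submatrices of the transformed matrix\<close>

lemma ballot_entry_Suc_left: "ballot_entry x y (Suc i) j = ballot_entry (x + 1) (Suc y) i j"
  by (simp add: ballot_entry_def algebra_simps)

lemma ballot_entry_Suc_right: "ballot_entry x (Suc y) i (Suc j) = ballot_entry (x + 2) y i j"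
  by (simp add: ballot_entry_def algebra_simps)

text \<open>
  This says that the parameter \<open>y - 1 = -1\<close>, which occurs in the condensation recurrence for \<open>y = 0\<close>,
  belongs to a strictly lower triangular matrix.
\<close>

lemma ballot_entry_0_Suc: "i \<le> j \<Longrightarrow> ballot_entry x 0 i (Suc j) = 0"
  by (simp add: ballot_entry_def gbinom_def)

text \<open>
  The product formula for the \<open>1\<times>1\<close> matrix. After extracting the common factor, the difference of the
  two binomial coefficients is \<open>(x + 2) (x + 3) - y (y - 1) = (x + 2 + y) (x + 3 - y)\<close>.
\<close>

lemma ballot_entry_diag:
  assumes "x > 0"
  shows "ballot_entry x y 0 0 =
    pochhammer (x + 1) (y + 2) * (x - y + 3) / (pochhammer (x + 1) 3 * fact y)"
proof -
  have pos: "pochhammer (x + 1) a > 0" for a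
    using assms by (intro pochhammer_pos) simp
  have p3: "pochhammer (x + 1) 3 = pochhammer (x + 1) (Suc (Suc 0)) * (x + 3)"
    by (simp add: numeral_3_eq_3 pochhammer_Suc)
  consider "y = 0" | "y = 1" | k where "y = Suc (Suc k)"
    by (metis One_nat_def not0_implies_Suc)
  then show ?thesis
  proof cases
    case 3
    \<comment> \<open>\<open>c = y (y - 1)\<close>; it is kept folded so that it cancels against \<open>fact y\<close>.\<close>
    define c where "c = (real k + 2) * (real k + 1)"
    have c: "c \<noteq> 0"
      by (simp add: c_def)
    have fact_y: "fact y = c * fact k"
      by (simp add: 3 c_def algebra_simps)
    have "ballot_entry x y 0 0 = (x + real k + 3 gchoose Suc (Suc k)) - (x + real k + 3 gchoose k)"
      by (simp add: ballot_entry_def gbinom_def 3 nat_add_distrib algebra_simps)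
    also have "\<dots> = (x + 2) * (x + 3) * pochhammer (x + 4) k / fact y - pochhammer (x + 4) k / fact k"
      by (simp add: gbinomial_pochhammer' pochhammer_rec 3 algebra_simps)
    also have "\<dots> = pochhammer (x + 4) k * ((x + 2) * (x + 3) - c) / fact y"
      using c by (simp add: fact_y diff_divide_distrib algebra_simps)
    also have "\<dots> = pochhammer (x + 1 + of_nat 3) k * (x + 4 + k) * (x - y + 3) / fact y"
      by (simp add: 3 c_def algebra_simps)
    also have "\<dots> = pochhammer (x + 1) (3 + Suc k) * (x - y + 3) / (pochhammer (x + 1) 3 * fact y)"
    proof -
      have "pochhammer (x + 1) (3 + Suc k) = pochhammer (x + 1) 3 * pochhammer (x + 1 + of_nat 3) (Suc k)"
        by (rule pochhammer_product')
      moreover have "pochhammer (x + 1) 3 > 0"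
        using assms by (intro pochhammer_pos) simp
      ultimately show ?thesis
        by (simp add: pochhammer_Suc field_simps)
    qed
    finally show ?thesis
      by (simp add: 3 numeral_eq_Suc)
  next
    case 1
    then show ?thesis
      using pos[of "Suc (Suc 0)"] assms by (simp add: ballot_entry_def gbinom_def numeral_2_eq_2 p3)
  next
    case 2
    then show ?thesis
      using pos[of 3] by (simp add: ballot_entry_def gbinom_def numeral_3_eq_3)
  qed
qed

section \<open>The product formula satisfies the condensation recurrence\<close>

text \<open>
  The factor of the product formula with index \<open>j + 1\<close>. A factorial \<open>fact (x + a)\<close> is written as
  \<open>pochhammer (x + 1) a\<close>, which makes sense for real \<open>x\<close>; the omitted \<open>fact x\<close> cancels in the quotient.
\<close>

definition prod_factor :: "nat \<Rightarrow> real \<Rightarrow> nat \<Rightarrow> nat \<Rightarrow> real" where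
  "prod_factor n x y j =
    fact j * pochhammer (x + 1) (y + 2 * j + 2) * pochhammer (x - y + 2 * j + 3) (j + 1)
      * pochhammer (x + 2 * y + 3 * j + 4) (n - 1 - j)
    / (pochhammer (x + 1) (n + 2 * j + 2) * fact (y + n - 1 - j))"

definition prod_formula :: "nat \<Rightarrow> real \<Rightarrow> nat \<Rightarrow> real" where
  "prod_formula n x y = (\<Prod>j<n. prod_factor n x y j)"

text \<open>
  The quotient of the product formulas for \<open>n + 1\<close> and \<open>n\<close>. Each of the \<open>n\<close> old factors gains one linear
  term in every factorial, rising or ordinary, that depends on \<open>n\<close>.
\<close>

definition new_factor :: "nat \<Rightarrow> real \<Rightarrow> nat \<Rightarrow> real" where
  "new_factor n x y = prod_factor (Suc n) x y n
    * (\<Prod>j<n. (x + 2 * real y + 2 * real j + n + 3) / ((x + n + 2 * real j + 3) * (real y + n - real j)))"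

lemma prod_formula_Suc:
  assumes "x > 0"
  shows "prod_formula (Suc n) x y = new_factor n x y * prod_formula n x y"
proof -
  let ?r = "\<lambda>j. (x + 2 * real y + 2 * real j + n + 3) / ((x + n + 2 * real j + 3) * (real y + n - real j))"
  have step: "prod_factor (Suc n) x y j = ?r j * prod_factor n x y j" if "j < n" for j
  proof -
    obtain k where k: "n = j + Suc k"
      using less_imp_Suc_add[OF \<open>j < n\<close>] by auto
    have "pochhammer (x + 1) (n + 2 * j + 2) > 0"
      using assms by (intro pochhammer_pos) simp
    moreover have "x + n + 2 * j + 3 > 0"
      using assms by simp
    moreover have "real (y + Suc k) > 0" "fact (y + k) > (0::real)" by simp_all
    ultimately show ?thesis
      by (simp add: prod_factor_def k pochhammer_Suc divide_simps) (simp add: algebra_simps)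
  qed
  have "(\<Prod>j<n. prod_factor (Suc n) x y j) = (\<Prod>j<n. ?r j) * prod_formula n x y"
    unfolding prod_formula_def prod.distrib[symmetric] by (intro prod.cong step) auto
  then show ?thesis
    by (simp add: prod_formula_def new_factor_def)
qed

lemma pochhammer_plus1: "x > 0 \<Longrightarrow> pochhammer (x + 2) a = pochhammer (x + 1) a * (x + 1 + a) / (x + 1)"
  for x :: real
  using pochhammer_rec[of "x + 1" a] pochhammer_Suc[of "x + 1" a]
  by (simp add: field_simps)

text \<open>
  In the product over \<open>j\<close>, passing from \<open>(m, x + 3)\<close> to \<open>(m + 1, x)\<close> only shifts the index: the term
  \<open>j + 1\<close> of the latter is the term \<open>j\<close> of the former. What remains is the term \<open>j = 0\<close> and the quotient
  of the two top factors.
\<close>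

lemma new_factor_Suc:
  assumes "x > 0"
  shows "new_factor (Suc m) x y * ((x + y + 2 * m + 5) * (real y + real m + 1) * (x + m + 4)) =
    ((real m + 1) * (x - y + 2 * m + 5) * (x + 2 * y + m + 4)) * new_factor m (x + 3) y"
proof -
  \<comment> \<open>\<open>u / (v w)\<close> is the term \<open>j = 0\<close>, and \<open>W\<close> the common part of the two products.\<close>
  define u v w W where "u = x + 2 * y + m + 4" and "v = x + m + 4" and "w = real y + real m + 1"
    and "W = (\<Prod>j<m. (x + 2 * real y + 2 * real j + m + 6)
      / ((x + m + 2 * real j + 6) * (real y + m - real j)))"
  have "(\<Prod>j<Suc m. (x + 2 * real y + 2 * real j + Suc m + 3)
      / ((x + Suc m + 2 * real j + 3) * (real y + Suc m - real j)))
     = u / (v * w) * W"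
    unfolding u_def v_def w_def W_def by (subst prod.lessThan_Suc_shift) (simp add: algebra_simps)
  then have new: "new_factor (Suc m) x y = prod_factor (Suc (Suc m)) x y (Suc m) * (u / (v * w) * W)"
    by (simp only: new_factor_def)
  have "(\<Prod>j<m. (x + 3 + 2 * real y + 2 * real j + m + 3)
      / ((x + 3 + m + 2 * real j + 3) * (real y + m - real j))) = W"
    unfolding W_def by (intro prod.cong) (auto simp: algebra_simps)
  then have old: "new_factor m (x + 3) y = prod_factor (Suc m) (x + 3) y m * W"
    by (simp only: new_factor_def)
  have top: "prod_factor (Suc (Suc m)) x y (Suc m) * (x + y + 2 * m + 5) =
      (real m + 1) * (x - y + 2 * m + 5) * prod_factor (Suc m) (x + 3) y m"
  proof -
    have pos: "pochhammer (x + 4) a > 0" for a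
      using assms by (intro pochhammer_pos) simp
    have "x + 1 + of_nat 3 = x + 4"
      by simp
    then have p: "pochhammer (x + 1) (3 + a) = pochhammer (x + 1) 3 * pochhammer (x + 4) a" for a
      using pochhammer_product'[of "x + 1" 3 a] by (simp only:)
    have p3: "pochhammer (x + 1) 3 > 0"
      using assms by (intro pochhammer_pos) simp
    have idx: "y + 2 * Suc m + 2 = y + 2 * m + 4" "Suc (Suc m) + 2 * Suc m + 2 = 3 + (3 * m + 3)"
      "Suc m + 1 = m + 2" "Suc (Suc m) - 1 - Suc m = 0" "y + Suc (Suc m) - 1 - Suc m = y"
      "Suc m + 2 * m + 2 = 3 * m + 3" "Suc m - 1 - m = 0" "y + Suc m - 1 - m = y"
      by simp_all
    have arg: "x - y + real (2 * Suc m) + 3 = x - y + 2 * m + 5" "x + 3 + 1 = x + 4"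
      "x + 3 - y + real (2 * m) + 3 = x - y + 2 * m + 5 + 1"
      "x + y + 2 * m + 5 = x + 1 + real (y + 2 * m + 4)"
      by simp_all
    have "prod_factor (Suc (Suc m)) x y (Suc m) = fact (Suc m) * pochhammer (x + 1) (y + 2 * m + 4)
        * pochhammer (x - y + 2 * m + 5) (m + 2) / (pochhammer (x + 1) (3 + (3 * m + 3)) * fact y)"
      unfolding prod_factor_def idx arg(1) by simp
    then have "prod_factor (Suc (Suc m)) x y (Suc m) * (x + y + 2 * m + 5) =
      fact (Suc m) * (pochhammer (x + 1) (Suc (y + 2 * m + 4)) * pochhammer (x - y + 2 * m + 5) (m + 2))
         / (pochhammer (x + 1) (3 + (3 * m + 3)) * fact y)"
      unfolding arg(4) pochhammer_Suc[of "x + 1" "y + 2 * m + 4"]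
      by (simp only: ac_simps times_divide_eq_left times_divide_eq_right)
    also have "Suc (y + 2 * m + 4) = 3 + (y + 2 * m + 2)"
      by simp
    also have "m + 2 = Suc (m + 1)"
      by simp
    also have "fact (Suc m) * (pochhammer (x + 1) (3 + (y + 2 * m + 2))
        * pochhammer (x - y + 2 * m + 5) (Suc (m + 1))) / (pochhammer (x + 1) (3 + (3 * m + 3)) * fact y)
       = (real m + 1) * (x - y + 2 * m + 5) * (fact m * pochhammer (x + 4) (y + 2 * m + 2)
        * pochhammer (x - y + 2 * m + 5 + 1) (m + 1) / (pochhammer (x + 4) (3 * m + 3) * fact y))"
      using p3 unfolding p pochhammer_rec[of _ "m + 1"] by simp
    also have "fact m * pochhammer (x + 4) (y + 2 * m + 2)
        * pochhammer (x - y + 2 * m + 5 + 1) (m + 1) / (pochhammer (x + 4) (3 * m + 3) * fact y)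
       = prod_factor (Suc m) (x + 3) y m"
      unfolding prod_factor_def idx(6-) arg(2,3) by simp
    finally show ?thesis .
  qed
  have "v \<noteq> 0" "w \<noteq> 0"
    using assms by (simp_all add: v_def w_def)
  then have "new_factor (Suc m) x y * ((x + y + 2 * m + 5) * w * v)
      = prod_factor (Suc (Suc m)) x y (Suc m) * (x + y + 2 * m + 5) * (u * W)"
    unfolding new by simp
  also have "\<dots> = ((real m + 1) * (x - y + 2 * m + 5) * u) * new_factor m (x + 3) y"
    unfolding top old by (simp only: ac_simps)
  finally show ?thesis
    unfolding u_def v_def w_def .
qed

lemma pochhammer_exchange:
  fixes x :: real
  assumes "x > 0"
  shows "pochhammer (x + 2) a * pochhammer (x + 3) a =
    (x + 3) / (x + 1) * ((x + a + 1) / (x + a + 3)) * (pochhammer (x + 1) a * pochhammer (x + 4) a)"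
proof -
  have "pochhammer (x + 3) a = pochhammer (x + 4) a * (x + 3) / (x + a + 3)"
    using pochhammer_plus1[of "x + 2" a] assms by (simp add: divide_simps) (simp add: algebra_simps)
  then show ?thesis
    using pochhammer_plus1[of x a] assms by (simp add: ac_simps)
qed

text \<open>
  Between \<open>(x+1, y+1), (x+2, y-1)\<close> and \<open>(x, y), (x+3, y)\<close> the multisets of values of \<open>x - y\<close> and of \<open>x + 2y\<close>
  agree, so the corresponding rising factorials cancel (here \<open>y\<close> is replaced by \<open>y + 1\<close>). Only the three
  kinds of factorials contribute, each by a quotient of consecutive terms in \<open>j\<close>, so the product over
  \<open>j\<close> will telescope.
\<close>

lemma prod_factor_exchange:
  assumes "x > 0" "j < m"
  shows "prod_factor m (x + 1) (Suc (Suc y)) j * prod_factor m (x + 2) y j =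
    ((x + y + 2 * j + 4) / (x + y + 2 * Suc j + 4)) * ((x + m + 2 * Suc j + 3) / (x + m + 2 * j + 3))
     * ((real y + 1 + m - Suc j) / (real y + 1 + m - j))
     * (prod_factor m x (Suc y) j * prod_factor m (x + 3) (Suc y) j)"
proof -
  obtain k where k: "m = j + Suc k"
    using less_imp_Suc_add[OF assms(2)] by auto
  \<comment> \<open>On the right, the rising factorials of \<open>x + 1\<close> and \<open>x + 4\<close> have length \<open>a\<close> above and \<open>b\<close> below the fraction line.\<close>
  define a b where "a = y + 2 * j + 3" and "b = m + 2 * j + 2"
  define c where "c = (x + 3) / (x + 1)"
  define F where "F z = pochhammer (x + z)" for z
  \<comment> \<open>The factors of the numerators that are common to both sides.\<close>
  define G where "G = fact j * fact j * pochhammer (x - y + 2 * j + 2) (j + 1)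
     * pochhammer (x - y + 2 * j + 5) (j + 1)
     * pochhammer (x + 2 * y + 3 * j + 6) k * pochhammer (x + 2 * y + 3 * j + 9) k"
  have F: "F 2 l * F 3 l = c * ((x + l + 1) / (x + l + 3)) * (F 1 l * F 4 l)" for l
    unfolding F_def c_def by (rule pochhammer_exchange[OF assms(1)])
  have pos: "F z l > 0" if "z > 0" for z l
    using that assms(1) by (auto simp: F_def intro!: pochhammer_pos)
  have c: "c > 0"
    using assms(1) by (simp add: c_def)
  have a: "a = Suc (y + 2 * j + 2)"
    by (simp add: a_def)
  have "F 2 (Suc a) = F 2 a * (x + 2 + a)"
    by (simp add: F_def pochhammer_Suc)
  moreover have "F 3 a = F 3 (y + 2 * j + 2) * (x + 2 + a)"
    unfolding a F_def pochhammer_Suc by simp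
  ultimately have num: "F 2 (Suc a) * F 3 (y + 2 * j + 2) = F 2 a * F 3 a"
    by simp
  have "prod_factor m (x + 1) (Suc (Suc y)) j * prod_factor m (x + 2) y j =
    G * (F 2 (Suc a) * F 3 (y + 2 * j + 2)) / ((F 2 b * F 3 b) * (fact (y + k) * fact (Suc (Suc (y + k)))))"
    by (simp add: prod_factor_def F_def G_def a_def b_def k eval_nat_numeral algebra_simps)
  also have "\<dots> = ((x + a + 1) / (x + a + 3)) * ((x + b + 3) / (x + b + 1))
     * (G * (F 1 a * F 4 a) / ((F 1 b * F 4 b) * (fact (y + k) * fact (Suc (Suc (y + k))))))"
  proof -
    have "F 1 b \<noteq> 0" "F 4 b \<noteq> 0" "x + b + 3 \<noteq> 0" "x + b + 1 \<noteq> 0" "x + a + 3 \<noteq> 0"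
      using pos[of 1 b] pos[of 4 b] assms(1) by auto
    then show ?thesis
      unfolding num F using c by (simp add: divide_simps) 
  qed
  also have "fact (y + k) * fact (Suc (Suc (y + k))) =
      (real (y + k) + 2) / (real (y + k) + 1) * (fact (Suc (y + k)) * fact (Suc (y + k)))"
    by (simp add: divide_simps) (simp add: algebra_simps)
  also have "G * (F 1 a * F 4 a) / (F 1 b * F 4 b
      * ((real (y + k) + 2) / (real (y + k) + 1) * (fact (Suc (y + k)) * fact (Suc (y + k)))))
     = ((real (y + k) + 1) / (real (y + k) + 2))
      * (G * (F 1 a * F 4 a) / (F 1 b * F 4 b * (fact (Suc (y + k)) * fact (Suc (y + k)))))"
    by (simp only: ac_simps times_divide_eq_left times_divide_eq_right
        divide_divide_eq_left divide_divide_eq_right)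
  also have "G * (F 1 a * F 4 a) / (F 1 b * F 4 b * (fact (Suc (y + k)) * fact (Suc (y + k))))
     = prod_factor m x (Suc y) j * prod_factor m (x + 3) (Suc y) j"
    by (simp add: prod_factor_def F_def G_def a_def b_def k eval_nat_numeral algebra_simps)
  finally have eq: "prod_factor m (x + 1) (Suc (Suc y)) j * prod_factor m (x + 2) y j =
    ((x + a + 1) / (x + a + 3)) * ((x + b + 3) / (x + b + 1)) * ((real (y + k) + 1) / (real (y + k) + 2)
     * (prod_factor m x (Suc y) j * prod_factor m (x + 3) (Suc y) j))" .
  have arg: "x + a + 1 = x + y + 2 * j + 4" "x + a + 3 = x + y + 2 * Suc j + 4"
      "x + b + 3 = x + m + 2 * Suc j + 3" "x + b + 1 = x + m + 2 * j + 3"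
      "real (y + k) + 1 = real y + 1 + m - Suc j" "real (y + k) + 2 = real y + 1 + m - j"
    by (simp_all add: a_def b_def k)
  show ?thesis
    unfolding eq arg by (simp only: mult.assoc)
qed

lemma prod_formula_exchange:
  assumes "x > 0"
  shows "prod_formula m (x + 1) (Suc (Suc y)) * prod_formula m (x + 2) y
      * ((x + y + 2 * real m + 4) * (real y + 1 + real m) * (x + real m + 3)) =
    ((real y + 1) * (x + y + 4) * (x + 3 * real m + 3))
      * (prod_formula m x (Suc y) * prod_formula m (x + 3) (Suc y))"
proof -
  define f where "f j = x + y + 2 * real j + 4" for j
  define g where "g j = x + m + 2 * real j + 3" for j
  define h where "h j = real y + 1 + m - real j" for j
  have nz: "f j \<noteq> 0" "g j \<noteq> 0" "j \<le> m \<Longrightarrow> h j \<noteq> 0" for j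
    using assms by (auto simp: f_def g_def h_def)
  have "prod_formula m (x + 1) (Suc (Suc y)) * prod_formula m (x + 2) y =
     (\<Prod>j<m. prod_factor m (x + 1) (Suc (Suc y)) j * prod_factor m (x + 2) y j)"
    by (simp add: prod_formula_def prod.distrib)
  also have "\<dots> = (\<Prod>j<m. (f j / f (Suc j)) * (g (Suc j) / g j) * (h (Suc j) / h j)
     * (prod_factor m x (Suc y) j * prod_factor m (x + 3) (Suc y) j))"
    by (rule prod.cong) (auto simp: prod_factor_exchange[OF assms] f_def g_def h_def)
  also have "\<dots> = (\<Prod>j<m. f j / f (Suc j)) * (\<Prod>j<m. g (Suc j) / g j) * (\<Prod>j<m. h (Suc j) / h j)
     * (prod_formula m x (Suc y) * prod_formula m (x + 3) (Suc y))"
    by (simp only: prod_formula_def prod.distrib)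
  also have "\<dots> = (f 0 / f m) * (g m / g 0) * (h m / h 0)
     * (prod_formula m x (Suc y) * prod_formula m (x + 3) (Suc y))"
    using nz by (subst prod_lessThan_telescope prod_lessThan_telescope'; simp)+
  finally have "prod_formula m (x + 1) (Suc (Suc y)) * prod_formula m (x + 2) y * (f m * h 0 * g 0) =
      (h m * f 0 * g m) * (prod_formula m x (Suc y) * prod_formula m (x + 3) (Suc y))"
    using nz(1)[of m] nz(2)[of 0] nz(3)[of 0] by (simp add: divide_simps) (simp add: ac_simps)
  then show ?thesis
    by (simp add: f_def g_def h_def)
qed

text \<open>
  The left-hand side is \<open>S / D\<close> times the first product \<open>Q\<close> on the right by \<open>new_factor_Suc\<close>, and the
  subtracted term is \<open>T / D\<close> times \<open>Q\<close> by \<open>prod_formula_exchange\<close>. So the recurrence is the polynomial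
  identity \<open>S + T = D\<close>. The factor \<open>y\<close> of \<open>T\<close> matches the vanishing of the subtracted term at \<open>y = 0\<close>.
\<close>

lemma prod_formula_condensation:
  assumes "x > 0"
  shows "prod_formula (Suc (Suc m)) x y * prod_formula m (x + 3) y =
    prod_formula (Suc m) x y * prod_formula (Suc m) (x + 3) y
    - (if y = 0 then 0 else prod_formula (Suc m) (x + 1) (Suc y) * prod_formula (Suc m) (x + 2) (y - 1))"
proof -
  define D S T Q where "D = (x + y + 2 * m + 5) * (real y + real m + 1) * (x + m + 4)"
    and "S = (real m + 1) * (x - y + 2 * m + 5) * (x + 2 * y + m + 4)"
    and "T = y * (x + y + 3) * (x + 3 * m + 6)"
    and "Q = prod_formula (Suc m) x y * prod_formula (Suc m) (x + 3) y"
  have D: "D \<noteq> 0"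
    using assms by (simp add: D_def add_pos_nonneg) 
  have "S + T = D"
    by (simp add: D_def S_def T_def algebra_simps)
  have "prod_formula (Suc (Suc m)) x y * prod_formula m (x + 3) y * D
     = new_factor (Suc m) x y * D * prod_formula (Suc m) x y * prod_formula m (x + 3) y"
    by (simp add: prod_formula_Suc assms)
  also have "new_factor (Suc m) x y * D = S * new_factor m (x + 3) y"
    using new_factor_Suc[OF assms, of m y] by (simp add: D_def S_def)
  also have "S * new_factor m (x + 3) y * prod_formula (Suc m) x y * prod_formula m (x + 3) y = S * Q"
    using prod_formula_Suc[of "x + 3" m y] assms by (simp add: Q_def)
  finally have 1: "prod_formula (Suc (Suc m)) x y * prod_formula m (x + 3) y * D = S * Q" .
  have 2: "(if y = 0 then 0
      else prod_formula (Suc m) (x + 1) (Suc y) * prod_formula (Suc m) (x + 2) (y - 1)) * D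
     = T * Q"
  proof (cases y)
    case (Suc w)
    then show ?thesis
      using prod_formula_exchange[OF assms, of "Suc m" w] by (simp add: D_def T_def Q_def algebra_simps)
  qed (simp add: T_def)
  show ?thesis
    using D 1 2 \<open>S + T = D\<close> unfolding Q_def[symmetric]
    by (smt (verit) mult_right_cancel mult.commute distrib_right left_diff_distrib)
qed

section \<open>Evaluation for generic and for integral parameters\<close>

lemma prod_formula_nonzero:
  assumes "x > 0" "x \<notin> \<int>"
  shows "prod_formula n x y \<noteq> 0"
proof -
  have "pochhammer (x + 1) a \<noteq> 0" for a
    using assms pochhammer_pos[of "x + 1" a] by simp
  moreover have "pochhammer (x + 2 * y + 3 * j + 4) a \<noteq> 0" for a and j :: nat
    using assms pochhammer_pos[of "x + 2 * y + 3 * j + 4" a] by simp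
  moreover have "pochhammer (x - y + 2 * j + 3) a \<noteq> 0" for a and j :: nat
  proof
    assume "pochhammer (x - y + 2 * j + 3) a = 0"
    then obtain k where "x - y + 2 * j + 3 = - of_nat k"
      by (auto simp: pochhammer_eq_0_iff)
    then have "x = of_int (int y - 2 * int j - 3 - int k)"
      by simp
    with assms(2) show False
      by (metis Ints_of_int)
  qed
  ultimately show ?thesis
    by (simp add: prod_formula_def prod_factor_def)
qed

lemma det_ballot_mat_nonintegral:
  assumes "x > 0" "x \<notin> \<int>"
  shows "det (ballot_mat n x y) = prod_formula n x y"
  using assms
proof (induction n arbitrary: x y rule: less_induct)
  case (less n)
  consider "n = 0" | "n = 1" | m where "n = Suc (Suc m)"
    by (metis One_nat_def not0_implies_Suc)
  then show ?case
  proof cases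
    case 1
    then show ?thesis
      by (simp add: ballot_mat_def prod_formula_def)
  next
    case 2
    then have "det (ballot_mat n x y) = ballot_entry x y 0 0"
      by (simp add: ballot_mat_def det_single)
    also have "\<dots> = prod_formula n x y"
      using 2
      by (simp add: ballot_entry_diag less.prems prod_formula_def prod_factor_def numeral_3_eq_3 algebra_simps)
    finally show ?thesis .
  next
    case 3
    have notin: "x + 1 \<notin> \<int>" "x + 2 \<notin> \<int>" "x + 3 \<notin> \<int>"
      using less.prems(2) Ints_diff[of "x + 1" 1] Ints_diff[of "x + 2" 2] Ints_diff[of "x + 3" 3] by auto
    \<comment> \<open>At \<open>y = 0\<close> the last minor has a zero diagonal; \<open>y - 1\<close> would be truncated there.\<close>
    have col: "det (mat (Suc m) (Suc m) (\<lambda>(i, j). ballot_entry x y i (Suc j)))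
        = (if y = 0 then 0 else det (ballot_mat (Suc m) (x + 2) (y - 1)))"
    proof (cases y)
      case 0
      have "det (mat (Suc m) (Suc m) (\<lambda>(i, j). ballot_entry x 0 i (Suc j)))
          = prod_list (diag_mat (mat (Suc m) (Suc m) (\<lambda>(i, j). ballot_entry x 0 i (Suc j))))"
        by (rule det_lower_triangular[where n = "Suc m"]) (auto simp: ballot_entry_0_Suc)
      also have "\<dots> = 0"
        by (simp add: prod_list_diag_prod ballot_entry_0_Suc)
      finally show ?thesis
        using 0 by simp
    next
      case (Suc w)
      then show ?thesis
        by (simp add: ballot_mat_def ballot_entry_Suc_right)
    qed
    have both: "mat l l (\<lambda>(i, j). ballot_entry x y (Suc i) (Suc j)) = ballot_mat l (x + 3) y" for l
      by (simp add: ballot_mat_def ballot_entry_Suc_left ballot_entry_Suc_right add.commute)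
    have row: "mat l l (\<lambda>(i, j). ballot_entry x y (Suc i) j) = ballot_mat l (x + 1) (Suc y)" for l
      by (simp add: ballot_mat_def ballot_entry_Suc_left)
    have "det (ballot_mat n x y) * prod_formula m (x + 3) y
       = det (ballot_mat n x y) * det (ballot_mat m (x + 3) y)"
      using less 3 notin by simp
    also have "\<dots> = det (ballot_mat (Suc m) x y) * det (ballot_mat (Suc m) (x + 3) y)
        - det (ballot_mat (Suc m) (x + 1) (Suc y))
          * (if y = 0 then 0 else det (ballot_mat (Suc m) (x + 2) (y - 1)))"
      using det_condensation[of m "ballot_entry x y"] unfolding both row col
      by (simp add: ballot_mat_def 3)
    also have "\<dots> = prod_formula (Suc m) x y * prod_formula (Suc m) (x + 3) y
        - (if y = 0 then 0 else prod_formula (Suc m) (x + 1) (Suc y) * prod_formula (Suc m) (x + 2) (y - 1))"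
      using less.IH[of "Suc m"] less.prems 3 notin by simp
    also have "\<dots> = prod_formula n x y * prod_formula m (x + 3) y"
      using prod_formula_condensation[OF less.prems(1)] 3 by simp
    finally show ?thesis
      using prod_formula_nonzero[of "x + 3" m y] less.prems notin by simp
  qed
qed

lemma isCont_pochhammer: "isCont f a \<Longrightarrow> isCont (\<lambda>x. pochhammer (f x :: real) n) a"
  by (induction n) (auto simp: pochhammer_Suc intro!: continuous_intros)

lemma isCont_prod: "(\<And>i. i \<in> I \<Longrightarrow> isCont (f i) a) \<Longrightarrow> isCont (\<lambda>x. \<Prod>i\<in>I. f i x :: real) a"
  unfolding isCont_def by (rule tendsto_prod) auto

lemma isCont_prod_formula:
  assumes "x \<ge> 0"
  shows "isCont (\<lambda>x. prod_formula n x y) x"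
proof -
  have "pochhammer (x + 1) a \<noteq> 0" for a
    using assms pochhammer_pos[of "x + 1" a] by simp
  then show ?thesis
    unfolding prod_formula_def prod_factor_def
    by (intro isCont_prod continuous_intros isCont_pochhammer) auto
qed

lemma isCont_det_ballot_mat: "isCont (\<lambda>x. det (ballot_mat n x y)) x"
proof -
  have "isCont (\<lambda>x. gbinom (x + c) r) x" for c r
    by (cases "r < 0") (auto simp: gbinom_def gbinomial_pochhammer'
        intro!: continuous_intros isCont_pochhammer)
  then have "isCont (\<lambda>x. ballot_entry x y i j) x" for i j
    unfolding ballot_entry_def add.assoc by (intro continuous_intros) auto
  moreover have "det (ballot_mat n x y) = 
      (\<Sum>p | p permutes {0..<n}. signof p * (\<Prod>i = 0..<n. ballot_entry x y i (p i)))" for x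
    by (subst det_def'[of _ n]) (auto simp: ballot_mat_def permutes_in_image intro!: sum.cong prod.cong)
  ultimately show ?thesis
    by (simp del: sum.cong_simp) (intro continuous_intros isCont_prod; simp)
qed

text \<open>
  Both sides are continuous at \<open>x\<close> and agree on the interval \<open>(x, x + 1)\<close>, which contains no integers.
\<close>

lemma det_ballot_mat_of_nat: "det (ballot_mat n (real x) y) = prod_formula n (real x) y"
proof (rule tendsto_unique[OF trivial_limit_at_right_real])
  let ?D = "\<lambda>z. det (ballot_mat n z y)" and ?P = "\<lambda>z. prod_formula n z y"
  show "(?D \<longlongrightarrow> ?D (real x)) (at_right (real x))"
    using isCont_det_ballot_mat[where x = "real x"]
    by (simp add: isCont_def filterlim_at_split)
  have "\<forall>\<^sub>F z in at_right (real x). ?P z = ?D z"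
  proof (rule eventually_at_rightI[of _ "real x + 1"])
    fix z assume z: "z \<in> {real x<..<real x + 1}"
    have "z \<notin> \<int>"
    proof
      assume "z \<in> \<int>"
      then obtain k where "z = of_int k" by (auto elim: Ints_cases)
      with z have "of_int (int x) < (of_int k :: real)" "of_int k < (of_int (int x + 1) :: real)"
        by auto
      then show False
        by (simp only: of_int_less_iff)
    qed
    with z show "?P z = ?D z"
      by (subst det_ballot_mat_nonintegral) auto
  qed simp
  moreover have "(?P \<longlongrightarrow> ?P (real x)) (at_right (real x))"
    using isCont_prod_formula[of "real x" n y] by (simp add: isCont_def filterlim_at_split)
  ultimately show "(?D \<longlongrightarrow> ?P (real x)) (at_right (real x))"
    by (rule Lim_transform_eventually[rotated])
qed

lemma of_rat_pochhammer: "of_rat (pochhammer a n) = pochhammer (of_rat a :: 'a :: field_char_0) n"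
  by (induction n) (simp_all add: pochhammer_Suc of_rat_mult of_rat_add)

lemma of_rat_fact: "of_rat (fact n) = (fact n :: 'a :: field_char_0)"
  by (metis of_nat_fact of_rat_of_nat_eq)

theorem theorem1p10:
  fixes n x y :: nat
  assumes "n \<ge> 1"
  shows "rat_of_int (det (A_mat n x y)) =
    (\<Prod>j=1..n.
       (fact (j - 1) * fact (x + y + 2 * j)
         * pochhammer (rat_of_int (int x - int y + 2 * int j + 1)) j
         * pochhammer (rat_of_nat (x + 2 * y + 3 * j + 1)) (n - j))
       / (fact (x + n + 2 * j) * fact (y + n - j)))"
    (is "_ = ?rhs")
proof -
  have fact_x: "fact (x + a) = fact x * pochhammer (real x + 1) a" for a
    using pochhammer_product'[of "1 :: real" x a] by (simp add: pochhammer_fact add.commute)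
  have "real_of_rat (rat_of_int (det (A_mat n x y))) = prod_formula n (real x) y"
    by (simp add: det_A_mat_eq_det_ballot_mat det_ballot_mat_of_nat)
  also have "\<dots> = of_rat ?rhs"
    unfolding prod_formula_def prod.atLeast1_atMost_eq[folded One_nat_def] of_rat_prod
  proof (rule prod.cong)
    fix j assume "j \<in> {..<n}"
    have "fact (x + y + 2 * Suc j) = fact x * pochhammer (real x + 1) (y + 2 * j + 2)"
      "fact (x + n + 2 * Suc j) = fact x * pochhammer (real x + 1) (n + 2 * j + 2)"
      using fact_x[of "y + 2 * j + 2"] fact_x[of "n + 2 * j + 2"] by (simp_all add: algebra_simps)
    then show "prod_factor n (real x) y j = of_rat ((fact (Suc j - 1) * fact (x + y + 2 * Suc j)
         * pochhammer (rat_of_int (int x - int y + 2 * int (Suc j) + 1)) (Suc j)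
         * pochhammer (rat_of_nat (x + 2 * y + 3 * Suc j + 1)) (n - Suc j))
       / (fact (x + n + 2 * Suc j) * fact (y + n - Suc j)))"
      by (simp add: prod_factor_def of_rat_divide of_rat_mult of_rat_fact of_rat_pochhammer
          of_rat_add of_rat_diff algebra_simps del: fact_Suc)
  qed simp
  finally show ?thesis
    by (simp only: of_rat_eq_iff)
qed

end
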